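(* Let $n$ be a positive integer and $p$ be a prime such that $p + 1 < n < 2p$. (1) The triple $(n, n, np)$ is not index-realizable. (2) For any positive integer $\ell$, the triple $(n, n\ell, np\ell)$ is index-realizable if and only if $\binom{n}{p} \mid n\ell$.
   Context: A triple $(a,b,c)$ of positive integers is called index-realizable if there exists a group $G$ with finite index subgroups $H$ and $K$ such that $a = [G:H]$, $b = [G:K]$, and $c = [G : H\cap K]$. *)

theory Defs
  imports "HOL-Algebra.Coset" "HOL-Computational_Algebra.Primes" "HOL-Library.Infinite_Typeclass"
begin

definition finite_index :: "('a, 'm) monoid_scheme \<Rightarrow> 'a set \<Rightarrow> bool" where
  "finite_index G H \<longleftrightarrow> subgroup H G \<and> finite (rcosets\<^bsub>G\<^esub> H)"

text \<open>Meaningful as the index \<open>[G : H]\<close> only if it is finite, since \<^const>\<open>card\<close> is 0 on infinite sets.\<close>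
definition subgroup_index :: "('a, 'm) monoid_scheme \<Rightarrow> 'a set \<Rightarrow> nat" where
  "subgroup_index G H = card (rcosets\<^bsub>G\<^esub> H)"

text \<open>
  HOL cannot quantify over types inside a formula, so the type of the group elements is a
  parameter. The carrier of \<open>G\<close> may be any subset of that type, hence over an infinite type all
  groups on types of at most its cardinality, in particular all finite groups, occur up to
  isomorphism. (Over a finite type the existence of realizing groups can fail for lack of elements.)
\<close>
definition index_realizable :: "'a itself \<Rightarrow> nat \<Rightarrow> nat \<Rightarrow> nat \<Rightarrow> bool" where
  "index_realizable (_ :: 'a itself) a b c \<longleftrightarrow>
     (\<exists>(G :: 'a monoid) H K.
        group G \<and> finite_index G H \<and> finite_index G K \<and>
        a = subgroup_index G H \<and> b = subgroup_index G K \<and> c = subgroup_index G (H \<inter> K))"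

end

theory Submission
  imports Defs
    "HOL-Algebra.Sylow" "HOL-Algebra.Weak_Morphisms" "HOL-Algebra.Elementary_Groups"
    "HOL-Combinatorics.Permutations"
begin

text \<open>
  Let \<open>H\<close> and \<open>K\<close> have index \<open>n\<close> and \<open>b\<close> in \<open>G\<close>. The index of \<open>H \<inter> K\<close> is \<open>b\<close> times the length of the orbit
  of the point \<open>H\<close> when \<open>K\<close> acts on the \<open>n\<close> cosets of \<open>H\<close> (\<open>card_rcosets_Int\<close>). So both parts concern
  the case in which \<open>K\<close> has an orbit \<open>Y\<close> of prime length \<open>p\<close> on \<open>n < 2p\<close> points.

  In this case some subgroup of order \<open>p\<close> of the induced permutation group moves exactly \<open>p\<close> points
  (\<open>transitive_fixator_of_prime_orbit\<close>). A transitive group of degree less than \<open>2p\<close> with such a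
  subgroup is transitive on all \<open>p\<close>-sets of points (\<open>transitive_on_subsets\<close>). The stabilizer of \<open>Y\<close>
  in \<open>G\<close> thus has index \<open>n choose p\<close>, and since it contains \<open>K\<close>, we get \<open>n choose p\<close> divides \<open>b\<close>
  (\<open>choose_dvd_of_index_realizable\<close>). For \<open>b = n l\<close> this is the necessity of the divisibility, and
  for \<open>b = n\<close> it is absurd because \<open>n choose p\<close> exceeds \<open>n\<close> for \<open>2 \<le> p \<le> n - 2\<close>.

  Note that the group need not be the full symmetric or alternating group: for \<open>n = p + 2\<close> the group
  \<open>PSL(2, 8)\<close> on \<open>9\<close> points with \<open>p = 7\<close> is an exception. Transitivity on \<open>p\<close>-sets is
  the part of Jordan's theory of primitive groups that survives there, and it is all that is used.

  Conversely, a product of the symmetric group on \<open>n\<close> points with a cyclic group realizes every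
  multiple of \<open>n choose p\<close> as \<open>b\<close> (\<open>index_realizable_choose\<close>).
\<close>

section \<open>Permutation groups\<close>

text \<open>
  The symbol \<open>inv\<close> is kept for inverses in a group.
\<close>
abbreviation inv_fun :: "('x \<Rightarrow> 'y) \<Rightarrow> 'y \<Rightarrow> 'x" where
  "inv_fun \<equiv> inv_into UNIV"

text \<open>
  Permutation groups are plain sets of functions, so that a point stabilizer is again a
  permutation group, now on the set with that point removed, on the same type of points;
  the induction on the degree needs this. Points outside \<open>X\<close> are fixed because of \<^const>\<open>permutes\<close>.
\<close>
definition permutation_group :: "'x set \<Rightarrow> ('x \<Rightarrow> 'x) set \<Rightarrow> bool" where
  "permutation_group X P \<longleftrightarrow>
     id \<in> P \<and> (\<forall>g\<in>P. g permutes X \<and> inv_fun g \<in> P) \<and> (\<forall>g\<in>P. \<forall>h\<in>P. g \<circ> h \<in> P)"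

definition transitive_on :: "'x set \<Rightarrow> ('x \<Rightarrow> 'x) set \<Rightarrow> bool" where
  "transitive_on X P \<longleftrightarrow> (\<forall>x\<in>X. \<forall>y\<in>X. \<exists>g\<in>P. g x = y)"

lemma transitive_on_mono: "transitive_on X A \<Longrightarrow> A \<subseteq> B \<Longrightarrow> transitive_on X B"
  unfolding transitive_on_def by blast

definition fixator :: "('x \<Rightarrow> 'x) set \<Rightarrow> 'x set \<Rightarrow> ('x \<Rightarrow> 'x) set" where
  "fixator P D = {g \<in> P. \<forall>z\<in>D. g z = z}"

definition permutation_monoid :: "('x \<Rightarrow> 'x) set \<Rightarrow> ('x \<Rightarrow> 'x) monoid" where
  "permutation_monoid P = \<lparr>carrier = P, monoid.mult = (\<circ>), one = id\<rparr>"

lemma permutation_monoid_simps [simp]: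
  "carrier (permutation_monoid P) = P"
  "monoid.mult (permutation_monoid P) = (\<circ>)"
  "one (permutation_monoid P) = id"
  by (simp_all add: permutation_monoid_def)

lemma permutation_groupD:
  assumes "permutation_group X P"
  shows "id \<in> P" "g \<in> P \<Longrightarrow> g permutes X" "g \<in> P \<Longrightarrow> inv_fun g \<in> P"
    "g \<in> P \<Longrightarrow> h \<in> P \<Longrightarrow> g \<circ> h \<in> P" "g \<in> P \<Longrightarrow> bij g"
  using assms by (auto simp: permutation_group_def permutes_bij)

lemma permutation_group_image_subset:
  assumes "permutation_group X P" "g \<in> P" "A \<subseteq> X"
  shows "g ` A \<subseteq> X"
  using image_mono[OF assms(3), of g] permutes_image[OF permutation_groupD(2)[OF assms(1,2)]] by simp

lemma permutation_group_card_image: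
  assumes "permutation_group X P" "g \<in> P"
  shows "card (g ` A) = card A"
  by (rule card_image[OF permutes_inj_on[OF permutation_groupD(2)[OF assms]]])

lemma group_permutation_monoid:
  assumes "permutation_group X P"
  shows "group (permutation_monoid P)"
proof (rule groupI)
  fix g assume g: "g \<in> carrier (permutation_monoid P)"
  have "inv_fun g \<circ> g = id"
    using g permutes_inv_o(2) permutation_groupD(2)[OF assms] by auto
  then show "\<exists>h\<in>carrier (permutation_monoid P). h \<otimes>\<^bsub>permutation_monoid P\<^esub> g = \<one>\<^bsub>permutation_monoid P\<^esub>"
    using g permutation_groupD(3)[OF assms] by auto
qed (use permutation_groupD[OF assms] in \<open>auto simp: comp_assoc\<close>)

lemma inv_permutation_monoid:
  assumes "permutation_group X P" "g \<in> P"
  shows "inv\<^bsub>permutation_monoid P\<^esub> g = inv_fun g"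
  using permutation_groupD[OF assms(1)] permutes_inv_o(2)[of g X] assms(2)
  by (intro group.inv_equality[OF group_permutation_monoid[OF assms(1)]]) auto

lemma subgroup_permutation_monoid:
  assumes "permutation_group X P" "permutation_group Y R" "R \<subseteq> P"
  shows "subgroup R (permutation_monoid P)"
proof (rule group.subgroupI[OF group_permutation_monoid[OF assms(1)]])
  fix g assume "g \<in> R"
  then show "inv\<^bsub>permutation_monoid P\<^esub> g \<in> R"
    using inv_permutation_monoid[OF assms(1), of g] permutation_groupD(3)[OF assms(2)] assms(3) by auto
qed (use permutation_groupD[OF assms(2)] assms(3) in auto)

lemma permutation_group_point_stabilizer:
  assumes "permutation_group X P"
  shows "permutation_group (X - {a}) {g \<in> P. g a = a}"
  unfolding permutation_group_def
proof (intro conjI ballI)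
  fix g assume "g \<in> {g \<in> P. g a = a}"
  then have g: "g \<in> P" "g a = a" "bij g" "g permutes X"
    using permutation_groupD[OF assms] by auto
  show "g permutes X - {a}"
    by (rule permutes_superset[OF g(4)]) (use g in auto)
  have "inv_fun g a = a" using g by (metis permutes_inverses(2))
  then show "inv_fun g \<in> {g \<in> P. g a = a}" using g permutation_groupD[OF assms] by auto
qed (use permutation_groupD[OF assms] in auto)

section \<open>Transitivity on sets of prime size\<close>

lemma transitive_fixator_image:
  assumes P: "permutation_group X P" and f: "f \<in> P" and t: "transitive_on S (fixator P (- S))"
  shows "transitive_on (f ` S) (fixator P (- (f ` S)))"
  unfolding transitive_on_def
proof (intro ballI)
  fix x y assume "x \<in> f ` S" "y \<in> f ` S"
  then obtain u v where uv: "u \<in> S" "v \<in> S" "x = f u" "y = f v" by auto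
  then obtain g where g: "g \<in> P" "\<forall>z. z \<notin> S \<longrightarrow> g z = z" "g u = v"
    using t unfolding transitive_on_def fixator_def by force
  have bf: "bij f" using permutation_groupD[OF P] f by auto
  let ?h = "f \<circ> g \<circ> inv_fun f"
  have "?h \<in> P" using permutation_groupD[OF P] f g by auto
  moreover have "?h x = y" using uv g bf by (simp add: bij_is_inj)
  moreover have "?h z = z" if "z \<notin> f ` S" for z
  proof -
    have "inv_fun f z \<notin> S" using that bf by (metis bij_inv_eq_iff imageI)
    then show ?thesis using g bf by (simp add: bij_is_surj surj_f_inv_f)
  qed
  ultimately show "\<exists>g\<in>fixator P (- (f ` S)). g x = y"
    unfolding fixator_def by (intro bexI[of _ ?h]) auto
qed

text \<open>
  Call two points equivalent if they lie in the same translates of \<open>S\<close>. By transitivity the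
  classes have a common size, which divides \<open>card X\<close> and, as \<open>S\<close> is a union of classes, also the
  prime \<open>card S\<close>. Since \<open>card X\<close> lies strictly between \<open>card S\<close> and \<open>2 * card S\<close>, the classes are
  singletons. Hence every \<open>x \<noteq> a\<close> lies in some translate that avoids \<open>a\<close>. Any two translates
  meet, for each has more than half of the points; so the groups that move only points of one
  such translate together connect all points other than \<open>a\<close>, and all of them fix \<open>a\<close>.
\<close>
lemma point_stabilizer_transitive:
  assumes P: "permutation_group X P" and tr: "transitive_on X P" and fin: "finite X"
    and S: "S \<subseteq> X" "prime (card S)" and n: "card S < card X" "card X < 2 * card S"
    and tS: "transitive_on S (fixator P (- S))" and a: "a \<in> X"
  shows "transitive_on (X - {a}) {g \<in> P. g a = a}"
proof -
  note PD = permutation_groupD[OF P]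
  \<comment> \<open>\<open>F\<close> is the set of translates of \<open>S\<close>, and \<open>C x\<close> is the class of the points that lie in
      the same translates as \<open>x\<close>.\<close>
  define F where "F = (\<lambda>g. g ` S) ` P"
  define E where "E x = {T \<in> F. x \<notin> T}" for x
  define C where "C x = {y \<in> X. E y = E x}" for x
  have F: "T \<subseteq> X" "card T = card S" "transitive_on T (fixator P (- T))" if T: "T \<in> F" for T
  proof -
    obtain f where f: "f \<in> P" "T = f ` S" using T by (auto simp: F_def)
    then show "T \<subseteq> X" using permutation_group_image_subset[OF P f(1) S(1)] by simp
    show "card T = card S" using permutation_group_card_image[OF P f(1)] f(2) by simp
    show "transitive_on T (fixator P (- T))"
      unfolding f(2) by (rule transitive_fixator_image[OF P f(1) tS])
  qed
  have finF: "finite F" using F(1) fin by (meson PowI finite_Pow_iff finite_subset subsetI)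
  have meet: "T \<inter> T' \<noteq> {}" if "T \<in> F" "T' \<in> F" for T T'
  proof
    assume "T \<inter> T' = {}"
    moreover have "finite T" "finite T'" using F(1) that fin finite_subset by metis+
    ultimately have "card (T \<union> T') = 2 * card S" using F(2) that by (simp add: card_Un_disjoint)
    moreover have "card (T \<union> T') \<le> card X" using F(1) that fin by (intro card_mono) auto
    ultimately show False using n by linarith
  qed
  have imF: "g ` T \<in> F" if g: "g \<in> P" and T: "T \<in> F" for g T
  proof -
    obtain f where "f \<in> P" "T = f ` S" using T by (auto simp: F_def)
    then show ?thesis
      unfolding F_def using PD(4)[OF g] by (intro image_eqI[of _ _ "g \<circ> f"]) (auto simp: image_comp)
  qed
  have Eg: "E (g x) = (`) g ` E x" if g: "g \<in> P" for g x
  proof (intro equalityI subsetI)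
    fix T assume "T \<in> E (g x)"
    then have T: "T \<in> F" "g x \<notin> T" by (auto simp: E_def)
    have b: "bij g" using PD g by auto
    have "g ` (inv_fun g ` T) = T" using b by (simp add: bij_is_surj image_f_inv_f)
    moreover have "inv_fun g ` T \<in> F" using imF PD(3) g T by auto
    moreover have "x \<notin> inv_fun g ` T" using T b by (metis bij_inv_eq_iff imageE)
    ultimately show "T \<in> (`) g ` E x" by (auto simp: E_def intro!: image_eqI[of _ _ "inv_fun g ` T"])
  next
    fix T assume "T \<in> (`) g ` E x"
    then obtain U where "U \<in> F" "x \<notin> U" "T = g ` U" by (auto simp: E_def)
    then show "T \<in> E (g x)" using g imF PD(5)[OF g] by (auto simp: E_def bij_def inj_image_mem_iff)
  qed
  have inj_im: "inj ((`) g)" if "g \<in> P" for g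
    using inj_image_eq_iff[OF bij_is_inj[OF PD(5)[OF that]]] by (intro injI) simp
  have Einj: "E (g x) = E (g y) \<longleftrightarrow> E x = E y" if "g \<in> P" for g x y
    using Eg[OF that] inj_image_eq_iff[OF inj_im[OF that]] by simp
  have finE: "finite (E x)" for x using finF by (auto simp: E_def)
  have cardE: "card (E x) = card (E y)" if xy: "x \<in> X" "y \<in> X" for x y
  proof -
    obtain g where g: "g \<in> P" "g x = y" using tr xy unfolding transitive_on_def by blast
    have "card ((`) g ` E x) = card (E x)"
      by (rule card_image) (use inj_im[OF g(1)] inj_on_subset in blast)
    then show ?thesis using Eg[OF g(1), of x] g(2) by simp
  qed
  have cardC: "card (C x) = card (C y)" if xy: "x \<in> X" "y \<in> X" for x y
  proof -
    obtain g where g: "g \<in> P" "g x = y" using tr xy unfolding transitive_on_def by blast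
    have "g ` C x = C y"
    proof (intro equalityI subsetI)
      fix z assume "z \<in> g ` C x"
      then obtain u where "z = g u" "u \<in> X" "E u = E x" by (auto simp: C_def)
      then show "z \<in> C y"
        unfolding C_def using Einj[OF g(1), of u x] g(2) permutes_in_image[OF PD(2)[OF g(1)]] by simp
    next
      fix z assume z: "z \<in> C y"
      obtain u where u: "u \<in> X" "z = g u"
        using permutes_image[OF PD(2)[OF g(1)]] z unfolding C_def by blast
      then show "z \<in> g ` C x"
        using z Einj[OF g(1), of u x] g(2) unfolding C_def by auto
    qed
    moreover have "card (g ` C x) = card (C x)"
      by (rule permutation_group_card_image[OF P g(1)])
    ultimately show ?thesis by simp
  qed
  \<comment> \<open>The classes all have the same size, so this size divides the size of every union of classes,
      in particular of \<open>X\<close> and of \<open>S\<close>.\<close>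
  have dvd: "card (C a) dvd card Y" if Y: "Y \<subseteq> X" "\<And>x. x \<in> Y \<Longrightarrow> C x \<subseteq> Y" for Y
  proof -
    have un: "\<Union>(C ` Y) = Y" using Y unfolding C_def by auto
    have fY: "finite Y" using Y(1) fin finite_subset by auto
    have "card (C a) * card (C ` Y) = card (\<Union>(C ` Y))"
    proof (rule card_partition)
      show "finite (C ` Y)" "finite (\<Union>(C ` Y))" using fY un by auto
      show "\<And>c. c \<in> C ` Y \<Longrightarrow> card c = card (C a)" using cardC a Y(1) by blast
      show "\<And>c1 c2. c1 \<in> C ` Y \<Longrightarrow> c2 \<in> C ` Y \<Longrightarrow> c1 \<noteq> c2 \<Longrightarrow> c1 \<inter> c2 = {}"
        unfolding C_def by auto
    qed
    then show ?thesis using un by (metis dvd_triv_left)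
  qed
  have "S \<in> F" unfolding F_def using PD(1) by (intro image_eqI[of _ _ id]) auto
  then have "card (C a) dvd card S"
    using S(1) by (intro dvd) (auto simp: C_def E_def)
  moreover have "card (C a) dvd card X" by (intro dvd) (auto simp: C_def)
  moreover have "\<not> card S dvd card X"
  proof
    assume "card S dvd card X"
    then obtain k where k: "card X = card S * k" by blast
    have "1 < k" "k < 2" using n unfolding k by (auto simp: mult.commute intro!: Suc_lessI gr0I)
    then show False by simp
  qed
  ultimately have "card (C a) = 1" using S(2) by (auto simp: prime_nat_iff)
  moreover have "a \<in> C a" using a by (simp add: C_def)
  ultimately have Ca: "C a = {a}" by (metis card_1_singletonE singletonD)
  \<comment> \<open>As \<open>P\<close> is transitive, all points are avoided by equally many translates. So if every translate
      that avoids \<open>a\<close> also avoids \<open>x\<close>, then \<open>a\<close> and \<open>x\<close> lie in the same translates.\<close>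
  have ex: "\<exists>T\<in>F. a \<notin> T \<and> x \<in> T" if x: "x \<in> X - {a}" for x
  proof (rule ccontr)
    assume "\<not> ?thesis"
    then have "E a \<subseteq> E x" unfolding E_def by auto
    moreover have "card (E a) = card (E x)" using x by (intro cardE a) simp
    ultimately have "E a = E x" by (rule card_subset_eq[OF finE])
    then have "x \<in> C a" using x unfolding C_def by auto
    then show False using Ca x by auto
  qed
  show ?thesis unfolding transitive_on_def
  proof (intro ballI)
    fix x y assume x: "x \<in> X - {a}" and y: "y \<in> X - {a}"
    \<comment> \<open>The path from \<open>x\<close> to \<open>y\<close> goes through a common point \<open>z\<close> of two translates that avoid \<open>a\<close>:
        inside each of them, the elements that fix its complement, hence \<open>a\<close>, act transitively.\<close>
    obtain T where T: "T \<in> F" "a \<notin> T" "x \<in> T" using ex[OF x] by auto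
    obtain U where U: "U \<in> F" "a \<notin> U" "y \<in> U" using ex[OF y] by auto
    obtain z where z: "z \<in> T" "z \<in> U" using meet[OF T(1) U(1)] by auto
    obtain g where g: "g \<in> P" "g a = a" "g x = z"
      using F(3)[OF T(1)] T z unfolding transitive_on_def fixator_def by fastforce
    obtain h where h: "h \<in> P" "h a = a" "h z = y"
      using F(3)[OF U(1)] U z unfolding transitive_on_def fixator_def by fastforce
    show "\<exists>g\<in>{g \<in> P. g a = a}. g x = y"
      using g h PD(4) by (intro bexI[of _ "h \<circ> g"]) auto
  qed
qed

text \<open>
  A special case of Jordan's theorem on primitive groups, by induction on the degree. A point
  outside \<open>T\<close> can be moved to a chosen point \<open>a\<close> outside \<open>S\<close>; then both sets lie in \<open>X - {a}\<close>, where
  the stabilizer of \<open>a\<close> is again transitive and still contains the elements that move only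
  points of \<open>S\<close>.
\<close>
lemma transitive_on_subsets:
  assumes "permutation_group X P" "transitive_on X P" "finite X"
    and "S \<subseteq> X" "prime (card S)" "card X < 2 * card S"
    and "transitive_on S (fixator P (- S))" and "T \<subseteq> X" "card T = card S"
  shows "\<exists>g\<in>P. g ` T = S"
  using assms
proof (induction "card X" arbitrary: X P T rule: less_induct)
  case less
  note P = less.prems(1) and tr = less.prems(2) and fin = less.prems(3)
    and S = less.prems(4,5) and n = less.prems(6) and tS = less.prems(7) and T = less.prems(8,9)
  note PD = permutation_groupD[OF P]
  show ?case
  proof (cases "card S < card X")
    case False
    then have "S = X" "T = X" using S T fin card_mono card_seteq by (metis not_less)+
    then show ?thesis using PD(1) by (intro bexI[of _ id]) auto
  next
    case True
    then have "S \<noteq> X" "T \<noteq> X" using T by auto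
    then obtain a b where ab: "a \<in> X" "a \<notin> S" "b \<in> X" "b \<notin> T" using S T by blast
    obtain g where g: "g \<in> P" "g b = a" using tr ab unfolding transitive_on_def by blast
    let ?Q = "{g \<in> P. g a = a}"
    have lt: "card (X - {a}) < card X" using ab fin by (meson card_Diff1_less)
    have "\<exists>h\<in>?Q. h ` (g ` T) = S"
    proof (rule less.hyps[OF lt permutation_group_point_stabilizer[OF P]])
      show "transitive_on (X - {a}) ?Q"
        by (rule point_stabilizer_transitive[OF P tr fin S True n tS ab(1)])
      show "finite (X - {a})" "S \<subseteq> X - {a}" "prime (card S)" using fin S ab by auto
      show "card (X - {a}) < 2 * card S" using lt n by simp
      have "fixator P (- S) \<subseteq> fixator ?Q (- S)" using ab by (auto simp: fixator_def)
      then show "transitive_on S (fixator ?Q (- S))"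
        using tS transitive_on_mono by blast
      show "card (g ` T) = card S" using T permutation_group_card_image[OF P g(1)] by simp
      have "inj g" using PD(5)[OF g(1)] bij_is_inj by auto
      have "a \<notin> g ` T" using g ab \<open>inj g\<close> by (metis inj_image_mem_iff)
      moreover have "g ` T \<subseteq> X" using permutation_group_image_subset[OF P g(1) T(1)] .
      ultimately show "g ` T \<subseteq> X - {a}" by auto
    qed
    then obtain h where "h \<in> P" "h ` (g ` T) = S" by auto
    then show ?thesis using PD(4) g(1) by (intro bexI[of _ "h \<circ> g"]) (auto simp: image_comp)
  qed
qed

section \<open>Indices of subgroups and orbit lengths\<close>

lemma card_image_cong_kernel:
  fixes f :: "'x \<Rightarrow> 'y" and g :: "'x \<Rightarrow> 'z"
  assumes "\<And>x y. x \<in> A \<Longrightarrow> y \<in> A \<Longrightarrow> f x = f y \<longleftrightarrow> g x = g y"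
  shows "card (f ` A) = card (g ` A)"
proof -
  have "g (inv_into A f (f x)) = g x" if "x \<in> A" for x
    using assms[OF inv_into_into[OF imageI[OF that, of f]] that] f_inv_into_f[OF imageI[OF that, of f]]
    by simp
  then have "bij_betw (\<lambda>z. g (inv_into A f z)) (f ` A) (g ` A)"
    using assms by (auto simp: bij_betw_def inj_on_def image_comp)
  then show ?thesis by (rule bij_betw_same_card)
qed

lemma (in group) rcosets_eq_image: "rcosets H = (\<lambda>g. H #> g) ` carrier G"
  by (auto simp: RCOSETS_def)

lemma (in group) r_coset_eq_iff:
  assumes "subgroup H G" "x \<in> carrier G" "y \<in> carrier G"
  shows "H #> x = H #> y \<longleftrightarrow> x \<otimes> inv y \<in> H"
proof
  assume "H #> x = H #> y"
  then show "x \<otimes> inv y \<in> H"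
    using coset_mult_inv2 coset_join1 assms subgroup.subset by (metis inv_closed m_closed)
next
  assume "x \<otimes> inv y \<in> H"
  then show "H #> x = H #> y"
    using coset_mult_inv1 coset_join2 assms subgroup.subset by (metis inv_closed m_closed)
qed

text \<open>
  The orbit-stabilizer principle in a form that needs no action: \<open>f\<close> may be any function whose
  fibres are the right cosets of \<open>M\<close>. The group may be infinite.
\<close>
lemma (in group) card_rcosets_stabilizer:
  assumes "subgroup M G"
    and "\<And>g h. g \<in> carrier G \<Longrightarrow> h \<in> carrier G \<Longrightarrow> f g = f h \<longleftrightarrow> g \<otimes> inv h \<in> M"
  shows "card (rcosets M) = card (f ` carrier G)"
  unfolding rcosets_eq_image
  by (rule card_image_cong_kernel) (simp add: r_coset_eq_iff assms)

text \<open>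
  This is \<open>[G : K] = [G : M] [M : K]\<close>, with \<open>[M : K]\<close> written as the number of cosets of \<open>K\<close> that
  are contained in \<open>M\<close>. Every coset of \<open>K\<close> arises exactly once by translating such a coset with
  the chosen representative of a coset of \<open>M\<close>. As this is a bijection, the equation holds without
  finiteness conditions.
\<close>
lemma (in group) card_rcosets_tower:
  assumes K: "subgroup K G" and M: "subgroup M G" and sub: "K \<subseteq> M"
  shows "card (rcosets K) = card (rcosets M) * card ((\<lambda>m. K #> m) ` M)"
proof -
  have MG: "M \<subseteq> carrier G" "K \<subseteq> carrier G" using M K subgroup.subset by auto
  have ex: "\<exists>r. r \<in> carrier G \<and> D = M #> r" if "D \<in> rcosets M" for D
    using that unfolding rcosets_eq_image by auto
  define r where "r D = (SOME r. r \<in> carrier G \<and> D = M #> r)" for D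
  have r: "r D \<in> carrier G" "M #> r D = D" if "D \<in> rcosets M" for D
    using someI_ex[OF ex[OF that]] unfolding r_def by auto
  have key: "K #> m #> r D = K #> (m \<otimes> r D)" if "m \<in> M" "D \<in> rcosets M" for m D
    using that r MG by (intro coset_mult_assoc) auto
  have "bij_betw (\<lambda>(D, C). C #> r D) ((rcosets M) \<times> (\<lambda>m. K #> m) ` M) (rcosets K)"
    unfolding bij_betw_def
  proof (intro conjI inj_onI equalityI subsetI)
    fix u v assume u: "u \<in> (rcosets M) \<times> (\<lambda>m. K #> m) ` M" and v: "v \<in> (rcosets M) \<times> (\<lambda>m. K #> m) ` M"
      and eq: "(\<lambda>(D, C). C #> r D) u = (\<lambda>(D, C). C #> r D) v"
    obtain D m where m: "D \<in> rcosets M" "m \<in> M" "u = (D, K #> m)" using u by auto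
    obtain E l where l: "E \<in> rcosets M" "l \<in> M" "v = (E, K #> l)" using v by auto
    have mG: "m \<in> carrier G" "l \<in> carrier G" using m l MG by auto
    have eq': "K #> (m \<otimes> r D) = K #> (l \<otimes> r E)" using eq m l key by simp
    then have "(m \<otimes> r D) \<otimes> inv (l \<otimes> r E) \<in> M"
      using r_coset_eq_iff[OF K] mG r[OF m(1)] r[OF l(1)] sub by auto
    then have "M #> (m \<otimes> r D) = M #> (l \<otimes> r E)"
      using r_coset_eq_iff[OF M] mG r[OF m(1)] r[OF l(1)] by auto
    moreover have "M #> (m \<otimes> r D) = D" "M #> (l \<otimes> r E) = E"
      using coset_mult_assoc[OF MG(1)] coset_join2[OF _ M] mG m l r[OF m(1)] r[OF l(1)] by metis+
    ultimately have DE: "D = E" by simp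
    have "r E \<otimes> (inv (r E) \<otimes> inv l) = inv l"
      using mG r(1)[OF l(1)] by (simp add: m_assoc[symmetric])
    then have "m \<otimes> inv l = (m \<otimes> r D) \<otimes> inv (l \<otimes> r E)"
      using mG r[OF m(1)] DE by (simp add: inv_mult_group m_assoc)
    then have "m \<otimes> inv l \<in> K" using r_coset_eq_iff[OF K] eq' mG r[OF m(1)] r[OF l(1)] by auto
    then show "u = v" using DE m l r_coset_eq_iff[OF K] mG by simp
  next
    fix C assume "C \<in> (\<lambda>(D, C). C #> r D) ` ((rcosets M) \<times> (\<lambda>m. K #> m) ` M)"
    then obtain D m where "D \<in> rcosets M" "m \<in> M" "C = K #> m #> r D" by auto
    then show "C \<in> rcosets K" using key r MG by (auto simp: rcosets_eq_image)
  next
    fix C assume "C \<in> rcosets K"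
    then obtain x where x: "x \<in> carrier G" "C = K #> x" by (auto simp: rcosets_eq_image)
    define D where "D = M #> x"
    have D: "D \<in> rcosets M" unfolding D_def rcosets_eq_image using x by auto
    have "x \<otimes> inv (r D) \<in> M" using r_coset_eq_iff[OF M x(1) r(1)[OF D]] r(2)[OF D] D_def by simp
    moreover have "C = K #> (x \<otimes> inv (r D)) #> r D"
      using coset_mult_assoc[OF MG(2)] x r(1)[OF D] by (simp add: m_assoc)
    ultimately show "C \<in> (\<lambda>(D, C). C #> r D) ` ((rcosets M) \<times> (\<lambda>m. K #> m) ` M)"
      using D by (intro image_eqI[of _ _ "(D, K #> (x \<otimes> inv (r D)))"]) auto
  qed
  then show ?thesis using bij_betw_same_card card_cartesian_product by metis
qed

text \<open>
  The last factor, which is \<open>[K : H \<inter> K]\<close>, is the size of the orbit of the point \<open>H\<close> when \<open>K\<close> acts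
  on the cosets of \<open>H\<close>.
\<close>
lemma (in group) card_rcosets_Int:
  assumes H: "subgroup H G" and K: "subgroup K G"
  shows "card (rcosets (H \<inter> K)) = card (rcosets K) * card ((\<lambda>k. H #> k) ` K)"
proof -
  have HK: "subgroup (H \<inter> K) G" by (rule subgroups_Inter_pair[OF H K])
  have "card ((\<lambda>k. (H \<inter> K) #> k) ` K) = card ((\<lambda>k. H #> k) ` K)"
  proof (rule card_image_cong_kernel)
    fix x y assume xy: "x \<in> K" "y \<in> K"
    then have "x \<in> carrier G" "y \<in> carrier G" "x \<otimes> inv y \<in> K"
      using subgroup.subset[OF K] subgroup.m_closed[OF K] subgroup.m_inv_closed[OF K] by auto
    then show "(H \<inter> K) #> x = (H \<inter> K) #> y \<longleftrightarrow> H #> x = H #> y"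
      by (simp add: r_coset_eq_iff H HK)
  qed
  then show ?thesis using card_rcosets_tower[OF HK K] by simp
qed

lemma card_orbit_times_stabilizer:
  assumes Q: "permutation_group X Q"
  shows "card ((\<lambda>q. q x) ` Q) * card {q \<in> Q. q x = x} = card Q"
proof -
  interpret G: group "permutation_monoid Q" by (rule group_permutation_monoid[OF Q])
  note QD = permutation_groupD[OF Q]
  note inv_eq = inv_permutation_monoid[OF Q]
  have T: "subgroup {q \<in> Q. q x = x} (permutation_monoid Q)"
    by (rule subgroup_permutation_monoid[OF Q permutation_group_point_stabilizer[OF Q]]) auto
  \<comment> \<open>Permutations compose from right to left, so right cosets of the stabilizer are separated by
      \<open>q \<mapsto> q\<inverse> x\<close> rather than by \<open>q \<mapsto> q x\<close>.\<close>
  have "card (rcosets\<^bsub>permutation_monoid Q\<^esub> {q \<in> Q. q x = x})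
      = card ((\<lambda>q. inv_fun q x) ` carrier (permutation_monoid Q))"
  proof (rule G.card_rcosets_stabilizer[OF T])
    fix g h assume gh: "g \<in> carrier (permutation_monoid Q)" "h \<in> carrier (permutation_monoid Q)"
    then have "g \<circ> inv_fun h \<in> Q" "bij g" using QD by auto
    then show "inv_fun g x = inv_fun h x \<longleftrightarrow>
        g \<otimes>\<^bsub>permutation_monoid Q\<^esub> inv\<^bsub>permutation_monoid Q\<^esub> h \<in> {q \<in> Q. q x = x}"
      using gh inv_eq[of h] bij_inv_eq_iff[of g "inv_fun h x" x] by auto
  qed
  also have "(\<lambda>q. inv_fun q x) ` carrier (permutation_monoid Q) = (\<lambda>q. q x) ` Q"
  proof (intro equalityI subsetI)
    fix y assume "y \<in> (\<lambda>q. q x) ` Q"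
    then obtain q where "q \<in> Q" "y = q x" by auto
    then show "y \<in> (\<lambda>q. inv_fun q x) ` carrier (permutation_monoid Q)"
      using QD(3,5) by (intro image_eqI[of _ _ "inv_fun q"]) (auto simp: inv_inv_eq)
  qed (use QD in auto)
  finally show ?thesis using G.lagrange[OF T] by (simp add: order_def)
qed

section \<open>From an orbit of prime length to a subgroup of prime order\<close>

text \<open>
  The prime \<open>p\<close> divides the order of \<open>Q\<close>, because it is an orbit length, so \<open>Q\<close> has a subgroup \<open>R\<close> of
  order \<open>p\<close>. The orbits of \<open>R\<close> have length \<open>1\<close> or \<open>p\<close>, and there is room for only one of length \<open>p\<close>.
  This orbit is \<open>S\<close>; \<open>R\<close> fixes all other points.
\<close>
lemma transitive_fixator_of_prime_orbit:
  assumes Q: "permutation_group X Q" and fin: "finite X" and p: "prime p" and n: "card X < 2 * p"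
    and x0: "card ((\<lambda>q. q x0) ` Q) = p"
  shows "\<exists>S\<subseteq>X. card S = p \<and> transitive_on S (fixator Q (- S))"
proof -
  note QD = permutation_groupD[OF Q]
  interpret G: group "permutation_monoid Q" by (rule group_permutation_monoid[OF Q])
  have finQ: "finite Q"
    using finite_subset[OF _ finite_permutations[OF fin], of Q] QD(2) by auto
  obtain m where "card Q = p * m"
    using card_orbit_times_stabilizer[OF Q, of x0] x0 by metis
  then have "\<exists>R. subgroup R (permutation_monoid Q) \<and> card R = p ^ 1"
    by (intro sylow_thm[OF p G.group_axioms, of 1 m]) (auto simp: order_def finQ)
  then obtain R where R: "subgroup R (permutation_monoid Q)" "card R = p" by auto
  have RQ: "R \<subseteq> Q" using subgroup.subset[OF R(1)] by simp
  note inv_eq = inv_permutation_monoid[OF Q]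
  have R': "permutation_group X R"
    unfolding permutation_group_def
    using subgroup.one_closed[OF R(1)] subgroup.m_closed[OF R(1)] subgroup.m_inv_closed[OF R(1)]
      QD(2) RQ inv_eq by fastforce
  note RD = permutation_groupD[OF R']
  define orb where "orb x = (\<lambda>r. r x) ` R" for x
  have orb_eq: "orb y = orb x" if y: "y \<in> orb x" for x y
  proof -
    obtain r where r: "r \<in> R" "y = r x" using y by (auto simp: orb_def)
    show ?thesis
    proof (intro equalityI subsetI)
      fix z assume "z \<in> orb y"
      then obtain s where "s \<in> R" "z = s y" by (auto simp: orb_def)
      then show "z \<in> orb x" using r RD(4) unfolding orb_def by (intro image_eqI[of _ _ "s \<circ> r"]) auto
    next
      fix z assume "z \<in> orb x"
      then obtain s where "s \<in> R" "z = s x" by (auto simp: orb_def)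
      then show "z \<in> orb y" using r RD(3,4,5) unfolding orb_def
        by (intro image_eqI[of _ _ "s \<circ> inv_fun r"]) (auto simp: bij_is_inj)
    qed
  qed
  have self: "x \<in> orb x" for x using RD(1) unfolding orb_def by (intro image_eqI[of _ _ id]) auto
  have card_orb: "card (orb x) = 1 \<or> card (orb x) = p" for x
  proof -
    have "p = card (orb x) * card {q \<in> R. q x = x}"
      using card_orbit_times_stabilizer[OF R', of x] R(2) by (simp add: orb_def)
    then have "card (orb x) dvd p" by (rule dvdI)
    then show ?thesis using p by (simp add: prime_nat_iff)
  qed
  have "\<exists>r\<in>R. r \<noteq> id"
  proof (rule ccontr)
    assume "\<not> ?thesis"
    then have "R \<subseteq> {id}" by auto
    then have "card R \<le> 1" using card_mono[of "{id}" R] by simp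
    then show False using R(2) prime_gt_1_nat[OF p] by simp
  qed
  then obtain r x where r: "r \<in> R" "r x \<noteq> x" by (auto simp: fun_eq_iff)
  define S where "S = orb x"
  have xX: "x \<in> X" using r RD(2) permutes_not_in by metis
  have orbX: "orb y \<subseteq> X" if "y \<in> X" for y
    using that RD(2) permutes_in_image unfolding orb_def by fastforce
  have "card S \<noteq> 1"
  proof
    assume "card S = 1"
    then obtain s where "S = {s}" by (rule card_1_singletonE)
    moreover have "x \<in> S" "r x \<in> S" using self r(1) by (auto simp: S_def orb_def)
    ultimately show False using r(2) by auto
  qed
  then have cS: "card S = p" using card_orb unfolding S_def by auto
  have SX: "S \<subseteq> X" unfolding S_def by (rule orbX[OF xX])
  have fixed: "q y = y" if q: "q \<in> R" and y: "y \<notin> S" for q y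
  proof (cases "y \<in> X")
    case True
    have "orb y \<inter> S = {}"
    proof (rule ccontr)
      assume "orb y \<inter> S \<noteq> {}"
      then obtain z where "z \<in> orb y" "z \<in> orb x" unfolding S_def by blast
      then have "orb y = S" using orb_eq unfolding S_def by metis
      then show False using self[of y] y by simp
    qed
    moreover have "finite (orb y)" "finite S" using orbX[OF True] SX fin finite_subset by auto
    ultimately have "card (orb y) + card S = card (orb y \<union> S)" by (simp add: card_Un_disjoint)
    also have "\<dots> \<le> card X" using orbX[OF True] SX fin by (intro card_mono) auto
    finally have "card (orb y) + card S \<le> card X" .
    then have "card (orb y) = 1" using n cS card_orb[of y] by auto
    then obtain s where "orb y = {s}" by (rule card_1_singletonE)
    moreover have "y \<in> orb y" "q y \<in> orb y" using self q by (auto simp: orb_def)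
    ultimately show ?thesis by auto
  next
    case False
    then show ?thesis using RD(2)[OF q] permutes_not_in by metis
  qed
  have "transitive_on S (fixator Q (- S))"
    unfolding transitive_on_def
  proof (intro ballI)
    fix y z assume y: "y \<in> S" and z: "z \<in> S"
    then have "z \<in> orb y" using orb_eq unfolding S_def by auto
    then obtain q where "q \<in> R" "z = q y" by (auto simp: orb_def)
    then show "\<exists>g\<in>fixator Q (- S). g y = z"
      using RQ fixed by (intro bexI[of _ q]) (auto simp: fixator_def)
  qed
  then show ?thesis using SX cS by auto
qed

section \<open>The action on cosets and necessity of the divisibility\<close>

text \<open>
  The action by right multiplication on the right cosets of \<open>H\<close>, extended by the identity to
  sets that are not cosets so that it yields permutations in the sense of \<^const>\<open>permutes\<close>.
\<close>
definition coset_translation ::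
  "('a, 'm) monoid_scheme \<Rightarrow> 'a set \<Rightarrow> 'a \<Rightarrow> 'a set \<Rightarrow> 'a set" where
  "coset_translation G H g C = (if C \<in> rcosets\<^bsub>G\<^esub> H then C #>\<^bsub>G\<^esub> g else C)"

context group
begin

lemma coset_translation_apply:
  assumes "subgroup H G" "x \<in> carrier G" "g \<in> carrier G"
  shows "coset_translation G H g (H #> x) = H #> (x \<otimes> g)"
  using assms coset_mult_assoc[OF subgroup.subset[OF assms(1)] assms(2,3)]
  by (auto simp: coset_translation_def rcosets_eq_image)

text \<open>
  Translation reverses products, which does no harm: the image of a subgroup is still closed
  under composition and inverses.
\<close>
lemma coset_translation_comp:
  assumes H: "subgroup H G" and g: "g \<in> carrier G" "h \<in> carrier G"
  shows "coset_translation G H h \<circ> coset_translation G H g = coset_translation G H (g \<otimes> h)"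
proof
  fix C
  show "(coset_translation G H h \<circ> coset_translation G H g) C = coset_translation G H (g \<otimes> h) C"
  proof (cases "C \<in> rcosets H")
    case True
    then obtain x where "x \<in> carrier G" "C = H #> x" by (auto simp: rcosets_eq_image)
    then show ?thesis using g by (simp add: coset_translation_apply[OF H] m_assoc)
  next
    case False
    then show ?thesis by (simp add: coset_translation_def)
  qed
qed

lemma coset_translation_one:
  assumes "subgroup H G"
  shows "coset_translation G H \<one> = id"
proof
  fix C
  show "coset_translation G H \<one> C = id C"
    using coset_mult_one subgroup.subset[OF assms]
    by (auto simp: coset_translation_def rcosets_eq_image coset_mult_assoc)
qed

lemma inv_coset_translation:
  assumes H: "subgroup H G" and g: "g \<in> carrier G"
  shows "inv_fun (coset_translation G H g) = coset_translation G H (inv g)"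
  by (rule inv_unique_comp) (simp_all add: coset_translation_comp coset_translation_one assms)

lemma coset_translation_permutes:
  assumes H: "subgroup H G" and g: "g \<in> carrier G"
  shows "coset_translation G H g permutes rcosets H"
proof (rule bij_imp_permutes)
  let ?t = "coset_translation G H"
  have closed: "?t h C \<in> rcosets H" if "h \<in> carrier G" "C \<in> rcosets H" for h C
    using that coset_translation_apply[OF H] by (auto simp: rcosets_eq_image)
  show "bij_betw (?t g) (rcosets H) (rcosets H)"
  proof (rule bij_betw_byWitness[where f' = "?t (inv g)"])
    show "\<forall>C\<in>rcosets H. ?t (inv g) (?t g C) = C"
      using fun_cong[OF coset_translation_comp[OF H g, of "inv g"]] g coset_translation_one[OF H] by simp
    show "\<forall>C\<in>rcosets H. ?t g (?t (inv g) C) = C"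
      using fun_cong[OF coset_translation_comp[OF H, of "inv g" g]] g coset_translation_one[OF H] by simp
  qed (use closed g in auto)
  show "?t g C = C" if "C \<notin> rcosets H" for C
    using that by (simp add: coset_translation_def)
qed

lemma permutation_group_coset_translation:
  assumes H: "subgroup H G" and K: "subgroup K G"
  shows "permutation_group (rcosets H) (coset_translation G H ` K)"
proof -
  have KG: "k \<in> carrier G" if "k \<in> K" for k using that subgroup.subset[OF K] by auto
  show ?thesis
    unfolding permutation_group_def
  proof (intro conjI ballI)
    show "id \<in> coset_translation G H ` K"
      using coset_translation_one[OF H] subgroup.one_closed[OF K] by (metis imageI)
  next
    fix f assume "f \<in> coset_translation G H ` K"
    then obtain k where k: "k \<in> K" "f = coset_translation G H k" by auto
    show "f permutes rcosets H" using k KG coset_translation_permutes[OF H] by simp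
    show "inv_fun f \<in> coset_translation G H ` K"
      using k KG inv_coset_translation[OF H] subgroup.m_inv_closed[OF K] by simp
    fix e assume "e \<in> coset_translation G H ` K"
    then obtain l where l: "l \<in> K" "e = coset_translation G H l" by auto
    have "f \<circ> e = coset_translation G H (l \<otimes> k)" using k l KG coset_translation_comp[OF H] by simp
    then show "f \<circ> e \<in> coset_translation G H ` K" using k l subgroup.m_closed[OF K] by simp
  qed
qed

lemma transitive_coset_translation:
  assumes H: "subgroup H G"
  shows "transitive_on (rcosets H) (coset_translation G H ` carrier G)"
  unfolding transitive_on_def
proof (intro ballI)
  fix C D assume "C \<in> rcosets H" "D \<in> rcosets H"
  then obtain x y where xy: "x \<in> carrier G" "C = H #> x" "y \<in> carrier G" "D = H #> y"
    by (auto simp: rcosets_eq_image)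
  have "x \<otimes> (inv x \<otimes> y) = y" using xy by (simp add: m_assoc[symmetric])
  then have "coset_translation G H (inv x \<otimes> y) C = D"
    using xy coset_translation_apply[OF H, of x "inv x \<otimes> y"] by simp
  then show "\<exists>f\<in>coset_translation G H ` carrier G. f C = D" using xy by auto
qed

text \<open>
  The orbit \<open>Y\<close> of the point \<open>H\<close> under \<open>K\<close> is a \<open>p\<close>-set, so \<open>K\<close> is contained in the stabilizer
  \<open>M\<close> of \<open>Y\<close> in the group. The whole group permutes all \<open>p\<close>-sets of cosets of \<open>H\<close> transitively by
  \<open>transitive_on_subsets\<close>, whose hypothesis comes from the action of \<open>K\<close>. Hence the index of \<open>M\<close> is
  the binomial coefficient, and it divides the index of \<open>K\<close>.
\<close>
lemma choose_dvd_card_rcosets: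
  assumes H: "subgroup H G" and K: "subgroup K G"
    and fin: "finite (rcosets H)" and p: "prime p" and n: "card (rcosets H) < 2 * p"
    and orb: "card ((\<lambda>k. H #> k) ` K) = p"
  shows "(card (rcosets H) choose p) dvd card (rcosets K)"
proof -
  let ?X = "rcosets H" and ?t = "coset_translation G H"
  let ?P = "?t ` carrier G"
  have G: "subgroup (carrier G) G" by (rule subgroup_self)
  have KG: "K \<subseteq> carrier G" by (rule subgroup.subset[OF K])
  have P: "permutation_group ?X ?P" by (rule permutation_group_coset_translation[OF H G])
  have Q: "permutation_group ?X (?t ` K)" by (rule permutation_group_coset_translation[OF H K])
  define Y where "Y = (\<lambda>k. H #> k) ` K"
  have tH: "?t g H = H #> g" if "g \<in> carrier G" for g
    using coset_translation_apply[OF H one_closed that] that coset_mult_one[OF subgroup.subset[OF H]]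
    by simp
  have "(\<lambda>q. q H) ` ?t ` K = Y" unfolding Y_def image_comp using tH KG by (intro image_cong) auto
  then have "card ((\<lambda>q. q H) ` ?t ` K) = p" using orb Y_def by simp
  from transitive_fixator_of_prime_orbit[OF Q fin p n this]
  obtain S where S: "S \<subseteq> ?X" "card S = p" "transitive_on S (fixator (?t ` K) (- S))" by auto
  have "fixator (?t ` K) (- S) \<subseteq> fixator ?P (- S)" using KG by (auto simp: fixator_def)
  then have tS: "transitive_on S (fixator ?P (- S))" by (rule transitive_on_mono[OF S(3)])
  have toS: "\<exists>g\<in>carrier G. ?t g ` T = S" if "T \<subseteq> ?X" "card T = p" for T
  proof -
    have "\<exists>f\<in>?P. f ` T = S"
      by (rule transitive_on_subsets[OF P transitive_coset_translation[OF H] fin S(1) _ _ tS that(1)])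
        (simp_all add: S(2) that(2) p n)
    then show ?thesis by simp
  qed
  have YX: "Y \<subseteq> ?X" "card Y = p" using KG orb by (auto simp: Y_def rcosets_eq_image)
  have comp: "?t h ` ?t g ` A = ?t (g \<otimes> h) ` A" if "g \<in> carrier G" "h \<in> carrier G" for g h A
    using coset_translation_comp[OF H that] by (metis image_comp)
  have one: "?t \<one> ` A = A" for A using coset_translation_one[OF H] by simp
  define M where "M = {g \<in> carrier G. ?t g ` Y = Y}"
  have M_iff: "?t g ` Y = ?t h ` Y \<longleftrightarrow> g \<otimes> inv h \<in> M" if gh: "g \<in> carrier G" "h \<in> carrier G" for g h
  proof
    assume eq: "?t g ` Y = ?t h ` Y"
    have "?t (g \<otimes> inv h) ` Y = ?t (inv h) ` ?t h ` Y" using comp gh eq by (metis inv_closed)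
    then have "?t (g \<otimes> inv h) ` Y = Y" using gh comp one by simp
    then show "g \<otimes> inv h \<in> M" using gh by (simp add: M_def)
  next
    assume "g \<otimes> inv h \<in> M"
    then have "?t h ` Y = ?t h ` ?t (g \<otimes> inv h) ` Y" by (simp add: M_def)
    also have "\<dots> = ?t g ` Y" using gh comp by (simp add: m_assoc)
    finally show "?t g ` Y = ?t h ` Y" by simp
  qed
  have M: "subgroup M G"
  proof (rule subgroupI)
    show "M \<subseteq> carrier G" by (auto simp: M_def)
    show "M \<noteq> {}" using one[of Y] by (auto simp: M_def)
    fix g assume g: "g \<in> M"
    then show "inv g \<in> M" using M_iff[of \<one> g] one[of Y] by (simp add: M_def)
    fix h assume "h \<in> M"
    then show "g \<otimes> h \<in> M" using g comp[of g h Y] by (simp add: M_def)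
  qed
  have KM: "K \<subseteq> M"
  proof
    fix k assume k: "k \<in> K"
    have "?t k (H #> l) \<in> Y" if "l \<in> K" for l
      using coset_translation_apply[OF H, of l k] subgroup.m_closed[OF K that k] that k KG
      by (auto simp: Y_def)
    then have "?t k ` Y \<subseteq> Y" unfolding Y_def by blast
    moreover have "card (?t k ` Y) = card Y"
      using permutation_group_card_image[OF Q] k by blast
    moreover have "finite Y" using YX(1) fin finite_subset by auto
    ultimately have "?t k ` Y = Y" by (intro card_subset_eq) auto
    then show "k \<in> M" using k KG by (auto simp: M_def)
  qed
  have "(\<lambda>g. ?t g ` Y) ` carrier G = {T. T \<subseteq> ?X \<and> card T = p}"
  proof (intro equalityI subsetI)
    fix T assume "T \<in> (\<lambda>g. ?t g ` Y) ` carrier G"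
    then obtain g where "g \<in> carrier G" "T = ?t g ` Y" by auto
    then show "T \<in> {T. T \<subseteq> ?X \<and> card T = p}"
      using permutation_group_image_subset[OF P _ YX(1), of "?t g"]
        permutation_group_card_image[OF P, of "?t g"] YX(2) by simp
  next
    fix T assume "T \<in> {T. T \<subseteq> ?X \<and> card T = p}"
    then obtain g where g: "g \<in> carrier G" "?t g ` T = S" using toS by blast
    obtain h where h: "h \<in> carrier G" "?t h ` Y = S" using toS YX by blast
    have "?t (h \<otimes> inv g) ` Y = ?t (inv g) ` ?t g ` T"
      using comp[of h "inv g" Y] g h by simp
    also have "\<dots> = T" using comp[of g "inv g" T] g one by simp
    finally show "T \<in> (\<lambda>g. ?t g ` Y) ` carrier G"
      using g h by (intro image_eqI[of _ _ "h \<otimes> inv g"]) auto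
  qed
  then have "card (rcosets M) = card {T. T \<subseteq> ?X \<and> card T = p}"
    using card_rcosets_stabilizer[OF M M_iff] by simp
  also have "\<dots> = card ?X choose p" by (rule n_subsets[OF fin])
  finally show ?thesis using card_rcosets_tower[OF K M KM] by simp
qed

end

lemma choose_dvd_of_index_realizable:
  assumes real: "index_realizable TYPE('a) n b (b * p)"
    and p: "prime p" and n: "n < 2 * p" and b: "b > 0"
  shows "(n choose p) dvd b"
proof -
  obtain G :: "'a monoid" and H K where G: "group G"
    and H: "finite_index G H" and K: "finite_index G K"
    and idx: "n = subgroup_index G H" "b = subgroup_index G K" "b * p = subgroup_index G (H \<inter> K)"
    using real unfolding index_realizable_def by blast
  interpret group G by (rule G)
  have sub: "subgroup H G" "subgroup K G" "finite (rcosets\<^bsub>G\<^esub> H)"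
    using H K by (auto simp: finite_index_def)
  have "b * p = b * card ((\<lambda>k. H #>\<^bsub>G\<^esub> k) ` K)"
    using card_rcosets_Int[OF sub(1,2)] idx by (simp add: subgroup_index_def)
  then have "card ((\<lambda>k. H #>\<^bsub>G\<^esub> k) ` K) = p" using b by simp
  then show ?thesis
    using choose_dvd_card_rcosets[OF sub p] n idx by (simp add: subgroup_index_def)
qed

text \<open>
  The row of the binomial coefficients is unimodal, so it suffices to compare \<open>n\<close> with \<open>n choose 2\<close>.
\<close>
lemma less_choose:
  fixes n k :: nat
  assumes "2 \<le> k" "k + 2 \<le> n" 
  shows "n < n choose k"
proof -
  have "4 \<le> n" using assms by simp
  then have "n < n choose 2"
  proof (induction n rule: dec_induct)
    case base
    then show ?case by (simp add: choose_two)
  next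
    case (step m)
    then show ?case by (simp add: numeral_2_eq_2)
  qed
  also have "n choose 2 \<le> n choose k"
  proof (cases "k \<le> n div 2")
    case True
    then show ?thesis using assms by (intro binomial_mono) auto
  next
    case False
    then have "n choose 2 \<le> n choose (n - k)" using assms by (intro binomial_mono) auto
    then show ?thesis using assms binomial_symmetric[of k n] by simp
  qed
  finally show ?thesis .
qed

section \<open>Realizing groups\<close>

text \<open>
  A finite group can be copied into any infinite type, and by Lagrange's theorem its indices
  are determined by cardinalities, which the copying preserves.
\<close>
lemma index_realizable_of_finite_group:
  fixes G :: "'x monoid"
  assumes G: "group G" and fin: "finite (carrier G)"
    and H: "subgroup H G" and K: "subgroup K G"
    and a: "order G = a * card H" and b: "order G = b * card K"
    and c: "order G = c * card (H \<inter> K)"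
  shows "index_realizable TYPE('b::infinite) a b c"
proof -
  interpret group G by (rule G)
  obtain f :: "'x \<Rightarrow> 'b" where f: "inj_on f (carrier G)"
    using arb_inj_on_finite_infinite[OF fin] by blast
  let ?I = "image_group f G"
  have iso: "f \<in> iso G ?I" and I: "group ?I"
    using inj_imp_image_group_iso[OF f] inj_imp_image_group_is_group[OF f] by auto
  interpret I: group ?I by (rule I)
  have hom: "group_hom G ?I f"
    using iso by (simp add: group_hom_def group_hom_axioms_def iso_def G I)
  have ord: "order ?I = order G" by (simp add: order_def image_group_carrier card_image f)
  have finI: "finite (carrier ?I)" using fin by (simp add: image_group_carrier)
  have *: "finite_index ?I (f ` L) \<and> subgroup_index ?I (f ` L) = d"
    if L: "subgroup L G" and d: "order G = d * card L" for L d
  proof -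
    have sub: "subgroup (f ` L) ?I"
      by (rule group_hom.subgroup_img_is_subgroup[OF hom L])
    have LG: "L \<subseteq> carrier G" by (rule subgroup.subset[OF L])
    have "card (f ` L) = card L" using card_image inj_on_subset[OF f LG] by blast
    then have "card (rcosets\<^bsub>?I\<^esub> (f ` L)) * card L = d * card L"
      using I.lagrange[OF sub] ord d by simp
    moreover have "card L > 0"
      using subgroup.one_closed[OF L] finite_subset[OF LG fin] card_gt_0_iff by blast
    moreover have "finite (rcosets\<^bsub>?I\<^esub> (f ` L))"
      using finI by (auto simp: RCOSETS_def)
    ultimately show ?thesis using sub by (simp add: finite_index_def subgroup_index_def)
  qed
  have "f ` H \<inter> f ` K = f ` (H \<inter> K)"
    using inj_on_image_Int[OF f subgroup.subset[OF H] subgroup.subset[OF K]] by simp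
  moreover have "subgroup (H \<inter> K) G" by (rule subgroups_Inter_pair[OF H K])
  ultimately show ?thesis
    using *[OF H a] *[OF K b] *[OF _ c] I unfolding index_realizable_def by metis
qed

definition set_stabilizer :: "'x set \<Rightarrow> 'x set \<Rightarrow> ('x \<Rightarrow> 'x) set" where
  "set_stabilizer X A = {g. g permutes X \<and> g ` A = A}"

lemma permutation_group_set_stabilizer: "permutation_group X (set_stabilizer X A)"
  unfolding permutation_group_def
proof (intro conjI ballI)
  fix g assume "g \<in> set_stabilizer X A"
  then have g: "g permutes X" "g ` A = A" by (auto simp: set_stabilizer_def)
  show "g permutes X" by (rule g(1))
  have "inv_fun g ` A = A"
    using g(2) image_inv_f_f[OF permutes_inj[OF g(1)], of A] by simp
  then show "inv_fun g \<in> set_stabilizer X A" 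
    using permutes_inv[OF g(1)] by (simp add: set_stabilizer_def)
next
  fix g h assume "g \<in> set_stabilizer X A" "h \<in> set_stabilizer X A"
  then show "g \<circ> h \<in> set_stabilizer X A"
    using image_comp[of g h A] by (simp add: set_stabilizer_def permutes_compose)
qed (auto simp: set_stabilizer_def)

text \<open>
  A permutation that maps \<open>A\<close> onto itself is the product of its restrictions to \<open>A\<close> and to the
  complement of \<open>A\<close>, and these two can be chosen independently.
\<close>
lemma card_set_stabilizer:
  fixes X :: "'x set"
  assumes fin: "finite X" and A: "A \<subseteq> X"
  shows "card (set_stabilizer X A) = fact (card A) * fact (card X - card A)"
proof -
  let ?S = "{u. u permutes A} \<times> {v. v permutes (X - A)}"
  have fA: "finite A" using A fin finite_subset by auto
  \<comment> \<open>Restriction to \<open>B\<close>, extended by the identity.\<close>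
  define res where "res B g = (\<lambda>x. if x \<in> B then g x else x)" for B :: "'x set" and g
  have "bij_betw (\<lambda>(u, v). u \<circ> v) ?S (set_stabilizer X A)"
  proof (rule bij_betw_byWitness[where f' = "\<lambda>g. (res A g, res (X - A) g)"])
    have "res A (u \<circ> v) = u \<and> res (X - A) (u \<circ> v) = v"
      if u: "u permutes A" and v: "v permutes (X - A)" for u v
    proof (intro conjI ext)
      fix x
      show "res A (u \<circ> v) x = u x"
        using permutes_not_in[OF u, of x] permutes_not_in[OF v, of x] by (simp add: res_def)
      show "res (X - A) (u \<circ> v) x = v x"
        using permutes_not_in[OF u, of "v x"] permutes_not_in[OF v, of x] permutes_in_image[OF v, of x]
        by (auto simp: res_def)
    qed
    then show "\<forall>w\<in>?S. (\<lambda>g. (res A g, res (X - A) g)) ((\<lambda>(u, v). u \<circ> v) w) = w" by auto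
    show "\<forall>g\<in>set_stabilizer X A. (\<lambda>(u, v). u \<circ> v) (res A g, res (X - A) g) = g"
    proof
      fix g assume "g \<in> set_stabilizer X A"
      then have g: "g permutes X" "g ` A = A" by (auto simp: set_stabilizer_def)
      have "g x \<notin> A" if "x \<notin> A" for x
        using g(2) that permutes_inj[OF g(1)] by (metis inj_image_mem_iff)
      then show "(\<lambda>(u, v). u \<circ> v) (res A g, res (X - A) g) = g"
        using permutes_not_in[OF g(1)] A by (auto simp: fun_eq_iff res_def)
    qed
    show "(\<lambda>(u, v). u \<circ> v) ` ?S \<subseteq> set_stabilizer X A"
    proof
      fix g assume "g \<in> (\<lambda>(u, v). u \<circ> v) ` ?S"
      then obtain u v where g: "g = u \<circ> v" "u permutes A" "v permutes (X - A)" by auto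
      have "u permutes X" "v permutes X"
        using permutes_subset[OF g(2) A] permutes_subset[OF g(3), of X] by auto
      moreover have "v ` A = A" using permutes_not_in[OF g(3)] by force
      ultimately show "g \<in> set_stabilizer X A"
        using g(1) permutes_compose permutes_image[OF g(2)] image_comp[of u v A]
        by (simp add: set_stabilizer_def)
    qed
    show "(\<lambda>g. (res A g, res (X - A) g)) ` set_stabilizer X A \<subseteq> ?S"
    proof -
      have "res A g permutes A \<and> res (X - A) g permutes (X - A)" if "g \<in> set_stabilizer X A" for g
      proof -
        have g: "g permutes X" "g ` A = A" using that by (auto simp: set_stabilizer_def)
        have "g ` (X - A) = X - A"
          using image_set_diff[OF permutes_inj[OF g(1)]] permutes_image[OF g(1)] g(2) by simp
        moreover have "res B g permutes B" if B: "g ` B = B" for B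
        proof (rule bij_imp_permutes)
          have "bij_betw g B B"
            using B permutes_inj_on[OF g(1)] by (simp add: bij_betw_def)
          then show "bij_betw (res B g) B B"
            by (rule bij_betw_cong[THEN iffD1, rotated]) (simp add: res_def)
        qed (simp add: res_def)
        ultimately show ?thesis using g(2) by simp
      qed
      then show ?thesis by auto
    qed
  qed
  then have "card (set_stabilizer X A) = card ?S" using bij_betw_same_card by metis
  also have "\<dots> = fact (card A) * fact (card (X - A))"
    using fin fA by (simp add: card_cartesian_product card_permutations)
  finally show ?thesis using A fA by (simp add: card_Diff_subset)
qed

text \<open>
  The realizing group is \<open>S\<^sub>n \<times> \<int>/t\<close> with \<open>H = S\<^bsub>n-1\<^esub> \<times> \<int>/t\<close>, the stabilizer of the point \<open>0\<close>, and
  \<open>K = (S\<^sub>p \<times> S\<^bsub>n-p\<^esub>) \<times> 1\<close>, where \<open>S\<^sub>p \<times> S\<^bsub>n-p\<^esub>\<close> is the stabilizer of the \<open>p\<close>-set \<open>{..<p}\<close>. The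
  point \<open>0\<close> lies in this set, so its orbit under \<open>K\<close> has length \<open>p\<close>; the cyclic factor multiplies
  the index of \<open>K\<close> by \<open>t\<close>.
\<close>
lemma index_realizable_choose:
  fixes n p t :: nat
  assumes "0 < p" "p \<le> n" "0 < t"
  shows "index_realizable TYPE('b::infinite) n ((n choose p) * t) ((n choose p) * t * p)"
proof -
  \<comment> \<open>The whole symmetric group is the stabilizer of the empty set, and the stabilizer of \<open>0\<close> is the
      symmetric group on the other points; so one count of set stabilizers serves for all four groups.\<close>
  let ?X = "{..<n}" and ?A = "{..<p}" and ?Z = "integer_mod_group t"
  let ?S = "set_stabilizer ?X {}"
  let ?G = "permutation_monoid ?S \<times>\<times> ?Z"
  define U where "U = set_stabilizer (?X - {0}) {}"
  define V where "V = set_stabilizer ?X ?A"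
  have V_perm: "permutation_group ?X V" and U_perm: "permutation_group (?X - {0}) U"
    and S_perm: "permutation_group ?X ?S"
    by (simp_all add: U_def V_def permutation_group_set_stabilizer)
  have US: "U \<subseteq> ?S" "V \<subseteq> ?S" by (auto simp: set_stabilizer_def U_def V_def intro: permutes_subset)
  have S: "group (permutation_monoid ?S)" by (rule group_permutation_monoid[OF S_perm])
  have Z: "group ?Z" by simp
  have U: "subgroup U (permutation_monoid ?S)" and V: "subgroup V (permutation_monoid ?S)"
    using subgroup_permutation_monoid S_perm U_perm V_perm US by blast+
  have UV: "U \<inter> V = set_stabilizer (?X - {0}) (?A - {0})"
  proof (intro equalityI subsetI)
    fix g assume "g \<in> U \<inter> V"
    then have g: "g permutes (?X - {0})" "g ` ?A = ?A" by (auto simp: U_def V_def set_stabilizer_def)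
    then have "g ` (?A - {0}) = ?A - {0}"
      using image_set_diff[OF permutes_inj[OF g(1)], of ?A "{0}"] permutes_not_in[OF g(1), of 0] by simp
    then show "g \<in> set_stabilizer (?X - {0}) (?A - {0})" using g by (simp add: set_stabilizer_def)
  next
    fix g assume "g \<in> set_stabilizer (?X - {0}) (?A - {0})"
    then have g: "g permutes (?X - {0})" "g ` (?A - {0}) = ?A - {0}" by (auto simp: set_stabilizer_def)
    have "?A = insert 0 (?A - {0})" using assms by auto
    then have "g ` ?A = ?A" using g(2) permutes_not_in[OF g(1), of 0] by (metis Diff_iff image_insert insertI1)
    moreover have "g permutes ?X" by (rule permutes_subset[OF g(1)]) auto
    ultimately show "g \<in> U \<inter> V" using g(1) by (simp add: U_def V_def set_stabilizer_def)
  qed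
  have cZ: "card (carrier ?Z) = t" "finite (carrier ?Z)"
    using assms by (simp_all add: carrier_integer_mod_group)
  have cS: "card ?S = fact n" by (simp add: card_set_stabilizer)
  have cU: "card U = fact (n - 1)" unfolding U_def using assms by (simp add: card_set_stabilizer)
  have cV: "card V = fact p * fact (n - p)" unfolding V_def using assms by (simp add: card_set_stabilizer)
  have "card (U \<inter> V) = fact (card (?A - {0})) * fact (card (?X - {0}) - card (?A - {0}))"
    unfolding UV using assms by (intro card_set_stabilizer) auto
  then have cUV: "card (U \<inter> V) = fact (p - 1) * fact (n - p)" using assms by simp
  have n_fact: "fact n = n * fact (n - 1)" and p_fact: "fact p = p * fact (p - 1)"
    using assms by (simp_all add: fact_reduce)
  have choose: "fact p * fact (n - p) * (n choose p) = fact n"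
    by (rule binomial_fact_lemma[OF assms(2)])
  have Int: "(U \<times> carrier ?Z) \<inter> (V \<times> {0}) = (U \<inter> V) \<times> {0}"
    using assms by (auto simp: carrier_integer_mod_group)
  show ?thesis
  proof (rule index_realizable_of_finite_group)
    show "group ?G" by (rule DirProd_group[OF S Z])
    have "finite ?S" using cS by (metis card.infinite fact_nonzero)
    then show "finite (carrier ?G)" using cZ by simp
    show "subgroup (U \<times> carrier ?Z) ?G"
      by (rule DirProd_subgroups[OF S U Z group.subgroup_self[OF Z]])
    show "subgroup (V \<times> {0}) ?G"
      using DirProd_subgroups[OF S V Z group.triv_subgroup[OF Z]] by simp
    show "order ?G = n * card (U \<times> carrier ?Z)"
      by (simp add: order_def card_cartesian_product cS cU cZ n_fact)
    show "order ?G = (n choose p) * t * card (V \<times> {0::int})"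
      by (simp add: order_def card_cartesian_product cS cV cZ flip: choose)
    show "order ?G = (n choose p) * t * p * card ((U \<times> carrier ?Z) \<inter> (V \<times> {0}))"
      unfolding Int
      by (simp add: order_def card_cartesian_product cS cUV cZ p_fact flip: choose)
  qed
qed

theorem theorem3p6:
  fixes n p :: nat
  assumes "n > 0" and "prime p" and "p + 1 < n" and "n < 2 * p"
  shows "\<not> index_realizable TYPE('a) n n (n * p) \<and>
    (\<forall>l::nat. l > 0 \<longrightarrow>
       (index_realizable TYPE('b::infinite) n (n * l) (n * p * l) \<longleftrightarrow> (n choose p) dvd n * l))"
proof (intro conjI allI impI)
  have "n < n choose p"
    using less_choose[of p n] prime_ge_2_nat[OF assms(2)] assms(3) by simp
  then show "\<not> index_realizable TYPE('a) n n (n * p)"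
    using choose_dvd_of_index_realizable[of n n p] assms(1,2,4) dvd_imp_le by (metis not_le)
next
  fix l :: nat assume l: "l > 0"
  have npl: "n * p * l = n * l * p" by simp
  show "index_realizable TYPE('b) n (n * l) (n * p * l) \<longleftrightarrow> (n choose p) dvd n * l"
  proof
    assume "index_realizable TYPE('b) n (n * l) (n * p * l)"
    then show "(n choose p) dvd n * l"
      unfolding npl using choose_dvd_of_index_realizable assms l by (metis nat_0_less_mult_iff)
  next
    assume "(n choose p) dvd n * l"
    then obtain t where t: "n * l = (n choose p) * t" by blast
    then have "0 < t" using assms(1) l by (metis mult_is_0 neq0_conv)
    then show "index_realizable TYPE('b) n (n * l) (n * p * l)"
      unfolding npl t using assms prime_gt_0_nat[OF assms(2)]
      by (intro index_realizable_choose) auto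
  qed
qed

end
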